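(* Let $G$ be a group, let $X$ be an infinite transitive $G$-space, and let $J$ be a translation invariant ideal in $\mathcal{P}_X$. For a subset $A$ of $X$, the following statements hold: (i) $A$ is $J$-large if and only if $\bigtriangleup_p(A)\neq\varnothing$ for each $p\in\check{J}$; (ii) $A$ is $J$-thick if and only if there exists $p\in\check{J}$ such that $\bigtriangleup_p(A)=Gp$; (iii) $A$ is $J$-prethick if and only if there exist $p\in\check{J}$ and $F\in[G]^{<\omega}$ such that $\bigtriangleup_p(FA)=Gp$; (iv) $A$ is $J$-small if and only if for every $p\in\check{J}$ and every $F\in[G]^{<\omega}$ we have $\bigtriangleup_p(FA)\neq Gp$.
   Context: $\mathcal{P}_X$ is the Boolean algebra of all subsets of $X$, and $[G]^{<\omega}$ is the family of all finite subsets of $G$. For $F\subseteq G$, $A\subseteq X$: $FA=\{ga: g\in F, a\in A\}$, $gA=\{ga:a\in A\}$. An ideal $J$ in $\mathcal{P}_X$ is a family of subsets of $X$ with $X\notin J$ such that $A,B\in J$ and $C\subseteq A$ imply $A\cup B\in J$ and $C\in J$ (the ideal $\{\varnothing\}$ is allowed). $J$ is translation invariant if $gA\in J$ for all $g\in G$, $A\in J$. A subset $A\subseteq X$ is: - $J$-large if $X=FA\cup I$ for some $F\in[G]^{<\omega}$ and $I\in J$; - $J$-small if $L\setminus A$ is $J$-large for every $J$-large subset $L$ of $X$; - $J$-thick if $Int_F(A)\notin J$ for each $F\in[G]^{<\omega}$, where $Int_F(A)=\{a\in A: Fa\subseteq A\}$; - $J$-prethick if $FA$ is $J$-thick for some $F\in[G]^{<\omega}$.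 $\beta X$ is the Stone–Čech compactification of the discrete space $X$, i.e. the space of ultrafilters on $X$, with points of $X$ identified with principal ultrafilters; $X^*=\beta X\setminus X$. For $g\in G$ and $p\in\beta X$, $gp=\{gP: P\in p\}$, and $Gp=\{gp:g\in G\}$. For $A\subseteq X$ and $p\in X^*$, the $p$-companion of $A$ is $\bigtriangleup_p(A)=\{gp: g\in G, A\in gp\}$. Finally, $\check{J}=\{p\in X^*: X\setminus I\in p\text{ for each }I\in J\}$. *)

theory Defs
  imports "HOL-Algebra.Group_Action"
begin

text \<open>
  A \<open>G\<close>-space is given by the library's \<^locale>\<open>group_action\<close>: a group \<open>G\<close>, a set \<open>X\<close> and a
  homomorphism \<open>\<phi>\<close> from \<open>G\<close> to the bijections of \<open>X\<close>.  For \<open>A \<subseteq> X\<close> the translate \<open>gA\<close> is the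
  image \<open>\<phi> g ` A\<close>.
\<close>

definition translates :: "('g \<Rightarrow> 'x \<Rightarrow> 'x) \<Rightarrow> 'g set \<Rightarrow> 'x set \<Rightarrow> 'x set" where
  "translates \<phi> F A = {\<phi> g a | g a. g \<in> F \<and> a \<in> A}"

text \<open>A family that is an ideal is taken to be nonempty, so the smallest ideal is \<open>{{}}\<close>.\<close>

definition set_ideal :: "'x set \<Rightarrow> 'x set set \<Rightarrow> bool" where
  "set_ideal X J \<longleftrightarrow> J \<subseteq> Pow X \<and> J \<noteq> {} \<and> X \<notin> J \<and>
     (\<forall>A\<in>J. \<forall>B\<in>J. A \<union> B \<in> J) \<and> (\<forall>A\<in>J. \<forall>C. C \<subseteq> A \<longrightarrow> C \<in> J)"

definition translation_invariant ::
    "('g, 'm) monoid_scheme \<Rightarrow> ('g \<Rightarrow> 'x \<Rightarrow> 'x) \<Rightarrow> 'x set set \<Rightarrow> bool" where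
  "translation_invariant G \<phi> J \<longleftrightarrow> (\<forall>g\<in>carrier G. \<forall>A\<in>J. \<phi> g ` A \<in> J)"

definition large_set ::
    "('g, 'm) monoid_scheme \<Rightarrow> 'x set \<Rightarrow> ('g \<Rightarrow> 'x \<Rightarrow> 'x) \<Rightarrow> 'x set set \<Rightarrow> 'x set \<Rightarrow> bool" where
  "large_set G X \<phi> J A \<longleftrightarrow>
     (\<exists>F I. finite F \<and> F \<subseteq> carrier G \<and> I \<in> J \<and> X = translates \<phi> F A \<union> I)"

definition small_set ::
    "('g, 'm) monoid_scheme \<Rightarrow> 'x set \<Rightarrow> ('g \<Rightarrow> 'x \<Rightarrow> 'x) \<Rightarrow> 'x set set \<Rightarrow> 'x set \<Rightarrow> bool" where
  "small_set G X \<phi> J A \<longleftrightarrow>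
     (\<forall>L. L \<subseteq> X \<and> large_set G X \<phi> J L \<longrightarrow> large_set G X \<phi> J (L - A))"

definition Int_translates :: "('g \<Rightarrow> 'x \<Rightarrow> 'x) \<Rightarrow> 'g set \<Rightarrow> 'x set \<Rightarrow> 'x set" where
  "Int_translates \<phi> F A = {a \<in> A. translates \<phi> F {a} \<subseteq> A}"

definition thick_set ::
    "('g, 'm) monoid_scheme \<Rightarrow> ('g \<Rightarrow> 'x \<Rightarrow> 'x) \<Rightarrow> 'x set set \<Rightarrow> 'x set \<Rightarrow> bool" where
  "thick_set G \<phi> J A \<longleftrightarrow>
     (\<forall>F. finite F \<and> F \<subseteq> carrier G \<longrightarrow> Int_translates \<phi> F A \<notin> J)"

definition prethick_set ::
    "('g, 'm) monoid_scheme \<Rightarrow> ('g \<Rightarrow> 'x \<Rightarrow> 'x) \<Rightarrow> 'x set set \<Rightarrow> 'x set \<Rightarrow> bool" where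
  "prethick_set G \<phi> J A \<longleftrightarrow>
     (\<exists>F. finite F \<and> F \<subseteq> carrier G \<and> thick_set G \<phi> J (translates \<phi> F A))"

definition ultrafilter_on :: "'x set \<Rightarrow> 'x set set \<Rightarrow> bool" where
  "ultrafilter_on X p \<longleftrightarrow> p \<subseteq> Pow X \<and> X \<in> p \<and> {} \<notin> p \<and>
     (\<forall>A\<in>p. \<forall>B\<in>p. A \<inter> B \<in> p) \<and>
     (\<forall>A\<in>p. \<forall>B. A \<subseteq> B \<and> B \<subseteq> X \<longrightarrow> B \<in> p) \<and>
     (\<forall>A. A \<subseteq> X \<longrightarrow> A \<in> p \<or> X - A \<in> p)"

definition principal_ultrafilter :: "'x set \<Rightarrow> 'x \<Rightarrow> 'x set set" where
  "principal_ultrafilter X x = {A. A \<subseteq> X \<and> x \<in> A}"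

text \<open>
  \<open>\<beta>X\<close> enters only through its points, so its topology is not introduced; a point \<open>x\<close> of \<open>X\<close>
  is identified with the principal ultrafilter at \<open>x\<close>.
\<close>

definition beta :: "'x set \<Rightarrow> 'x set set set" where
  "beta X = {p. ultrafilter_on X p}"

definition beta_remainder :: "'x set \<Rightarrow> 'x set set set" where
  "beta_remainder X = beta X - principal_ultrafilter X ` X"

definition translate_uf :: "('g \<Rightarrow> 'x \<Rightarrow> 'x) \<Rightarrow> 'g \<Rightarrow> 'x set set \<Rightarrow> 'x set set" where
  "translate_uf \<phi> g p = {\<phi> g ` P | P. P \<in> p}"

definition uf_orbit ::
    "('g, 'm) monoid_scheme \<Rightarrow> ('g \<Rightarrow> 'x \<Rightarrow> 'x) \<Rightarrow> 'x set set \<Rightarrow> 'x set set set" where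
  "uf_orbit G \<phi> p = {translate_uf \<phi> g p | g. g \<in> carrier G}"

definition companion ::
    "('g, 'm) monoid_scheme \<Rightarrow> ('g \<Rightarrow> 'x \<Rightarrow> 'x) \<Rightarrow> 'x set set \<Rightarrow> 'x set \<Rightarrow> 'x set set set" where
  "companion G \<phi> p A = {translate_uf \<phi> g p | g. g \<in> carrier G \<and> A \<in> translate_uf \<phi> g p}"

definition ideal_check :: "'x set \<Rightarrow> 'x set set \<Rightarrow> 'x set set set" where
  "ideal_check X J = {p \<in> beta_remainder X. \<forall>I\<in>J. X - I \<in> p}"

end

theory Submission
  imports Defs
begin

text \<open>
  Everything reduces to the characterization of large sets, which is an instance of the maximal
  ideal theorem.  The set \<open>A\<close> has an empty \<open>p\<close>-companion exactly when the ultrafilter \<open>p\<close> contains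
  the complement of every translate of \<open>A\<close>, and \<open>p\<close> is nonprincipal exactly when it contains the
  complement of every finite set.  Hence a point of \<open>\<check>J\<close> with empty companion is the
  same as a maximal ideal that contains \<open>J\<close>, all finite sets, and all translates of \<open>A\<close>.  Such a
  maximal ideal exists if and only if \<open>X\<close> is not of the form \<open>FA \<union> I \<union> D\<close> with \<open>I \<in> J\<close> and \<open>F\<close>, \<open>D\<close>
  finite.  The finite set \<open>D\<close> is harmless: \<open>X\<close> is infinite, so \<open>A\<close> or \<open>I\<close> has a point, and by
  transitivity finitely many translates of \<open>A\<close> or of \<open>I\<close> cover \<open>D\<close>.  So the condition says that \<open>A\<close> is
  not \<open>J\<close>-large (\<open>large_set_iff_companion\<close>).

  The other parts come from two dualities that do not mention ultrafilters.  A set is thick if and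
  only if its complement is not large (\<open>thick_set_iff\<close>), because the complement of \<open>Int\<^sub>F(A)\<close> is a
  union of finitely many translates of \<open>X - A\<close>; on the side of companions, passing from \<open>A\<close> to \<open>X - A\<close>
  exchanges the conditions \<open>\<triangle>\<^sub>p = Gp\<close> and \<open>\<triangle>\<^sub>p = {}\<close> because \<open>p\<close> is an ultrafilter.  A set is small if and
  only if it is not prethick (\<open>small_set_iff\<close>).  Inside the locales of group actions the space \<open>X\<close>
  is called \<open>E\<close>; the comments keep the letter \<open>X\<close>.
\<close>

section \<open>Ideals and ultrafilters\<close>

lemma set_idealI:
  assumes "J \<subseteq> Pow X" "J \<noteq> {}" "X \<notin> J"
    and "\<And>A B. A \<in> J \<Longrightarrow> B \<in> J \<Longrightarrow> A \<union> B \<in> J"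
    and "\<And>A C. A \<in> J \<Longrightarrow> C \<subseteq> A \<Longrightarrow> C \<in> J"
  shows "set_ideal X J"
  using assms by (simp add: set_ideal_def)

text \<open>
  The union of a chain of ideals omits \<open>X\<close>, so Zorn's lemma gives a maximal ideal.  If it contained
  neither \<open>A\<close> nor \<open>X - A\<close>, it could be enlarged by \<open>A\<close>; hence the complements of its members form an
  ultrafilter.
\<close>

lemma ideal_dual_ultrafilter_exists:
  assumes K: "set_ideal X K"
  obtains p where "ultrafilter_on X p" and "\<And>B. B \<in> K \<Longrightarrow> X - B \<in> p"
proof -
  let ?S = "{M. set_ideal X M \<and> K \<subseteq> M}"
  have "\<exists>M\<in>?S. \<forall>N\<in>?S. M \<subseteq> N \<longrightarrow> N = M"
  proof (rule subset_Zorn_nonempty)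
    show "?S \<noteq> {}" using K by blast
  next
    fix C assume ne: "C \<noteq> {}" and ch: "subset.chain ?S C"
    have C: "set_ideal X M" "K \<subseteq> M" if "M \<in> C" for M
      using ch that by (auto simp: subset.chain_def)
    have CX: "M \<subseteq> Pow X" "X \<notin> M" if "M \<in> C" for M
      using C(1)[OF that] by (simp_all add: set_ideal_def)
    have Cun: "A \<union> B \<in> M" if "M \<in> C" "A \<in> M" "B \<in> M" for M A B
      using C(1)[OF that(1)] that(2,3) by (simp add: set_ideal_def)
    have Csub: "B \<in> M" if "M \<in> C" "A \<in> M" "B \<subseteq> A" for M A B
      using C(1)[OF that(1)] that(2,3) by (auto simp: set_ideal_def)
    have un: "A \<union> B \<in> \<Union>C" if A: "A \<in> \<Union>C" and B: "B \<in> \<Union>C" for A B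
    proof -
      from A B obtain M N where MN: "M \<in> C" "A \<in> M" "N \<in> C" "B \<in> N" by blast
      from ch MN(1,3) have "M \<subseteq> N \<or> N \<subseteq> M"
        unfolding subset_chain_def by blast
      with MN show ?thesis using Cun by blast
    qed
    have KC: "K \<subseteq> \<Union>C" using ne C(2) by blast
    have "K \<noteq> {}" using K by (simp add: set_ideal_def)
    have "set_ideal X (\<Union>C)"
    proof (rule set_idealI)
      show "\<Union>C \<subseteq> Pow X" "X \<notin> \<Union>C" using CX by blast+
      show "\<Union>C \<noteq> {}" using \<open>K \<noteq> {}\<close> KC by blast
      show "B \<in> \<Union>C" if "A \<in> \<Union>C" "B \<subseteq> A" for A B using that Csub by blast
    qed (rule un)
    with KC show "\<Union>C \<in> ?S" by blast
  qed
  then obtain M where "M \<in> ?S" and maxS: "\<forall>N\<in>?S. M \<subseteq> N \<longrightarrow> N = M" ..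
  then have M: "set_ideal X M" "K \<subseteq> M" by simp_all
  have max: "N = M" if "set_ideal X N" "M \<subseteq> N" for N
    using maxS that M(2) by (metis (mono_tags, lifting) mem_Collect_eq subset_trans)
  from M(1) have MX: "M \<subseteq> Pow X" "M \<noteq> {}" "X \<notin> M"
    and Mun: "\<And>A B. A \<in> M \<Longrightarrow> B \<in> M \<Longrightarrow> A \<union> B \<in> M"
    and Msub: "\<And>A B. A \<in> M \<Longrightarrow> B \<subseteq> A \<Longrightarrow> B \<in> M"
    unfolding set_ideal_def by blast+
  have emp: "{} \<in> M" using MX(2) Msub by blast
  have ultra: "A \<in> M \<or> X - A \<in> M" if A: "A \<subseteq> X" for A
  proof (rule ccontr)
    assume n: "\<not> (A \<in> M \<or> X - A \<in> M)"
    \<comment> \<open>\<open>?N\<close> is the ideal generated by \<open>M\<close> and \<open>A\<close>; it is proper because \<open>X - A \<notin> M\<close>.\<close>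
    let ?N = "{B. B \<subseteq> X \<and> (\<exists>D\<in>M. B \<subseteq> A \<union> D)}"
    have AN: "A \<in> ?N" using A emp by blast
    have "set_ideal X ?N"
    proof (rule set_idealI)
      show "?N \<subseteq> Pow X" by blast
      show "?N \<noteq> {}" using AN by blast
      show "X \<notin> ?N"
      proof
        assume "X \<in> ?N"
        then obtain D where "D \<in> M" "X \<subseteq> A \<union> D" by blast
        then have "X - A \<in> M" using Msub[of D "X - A"] by blast
        with n show False by blast
      qed
    next
      fix B B' assume BB: "B \<in> ?N" "B' \<in> ?N"
      then obtain D D' where "D \<in> M" "D' \<in> M" "B \<subseteq> A \<union> D" "B' \<subseteq> A \<union> D'" by blast
      then have "D \<union> D' \<in> M" "B \<union> B' \<subseteq> A \<union> (D \<union> D')" using Mun by blast+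
      with BB show "B \<union> B' \<in> ?N" by blast
    next
      fix B B' assume "B \<in> ?N" "B' \<subseteq> B"
      then show "B' \<in> ?N" by blast
    qed
    moreover have "M \<subseteq> ?N" using MX(1) by blast
    ultimately have "?N = M" by (intro max)
    with AN n show False by blast
  qed
  let ?p = "{B. B \<subseteq> X \<and> X - B \<in> M}"
  have "ultrafilter_on X ?p"
    unfolding ultrafilter_on_def
  proof (intro conjI ballI allI impI)
    show "?p \<subseteq> Pow X" by blast
    show "X \<in> ?p" using emp by simp
    show "{} \<notin> ?p" using MX(3) by simp
  next
    fix A B assume "A \<in> ?p" "B \<in> ?p"
    then show "A \<inter> B \<in> ?p" using Mun[of "X - A" "X - B"] by (auto simp: Diff_Int)
  next
    fix A B assume "A \<in> ?p" "A \<subseteq> B \<and> B \<subseteq> X"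
    then show "B \<in> ?p" using Msub[of "X - A" "X - B"] by auto
  next
    fix A assume "A \<subseteq> X"
    then show "A \<in> ?p \<or> X - A \<in> ?p" using ultra[of A] by (auto simp: double_diff)
  qed
  moreover have "X - B \<in> ?p" if "B \<in> K" for B
    using that M(2) MX(1) by (auto simp: double_diff subset_iff)
  ultimately show thesis using that by blast
qed

lemma ultrafilter_on_Diff_iff:
  assumes "ultrafilter_on X p" "A \<subseteq> X"
  shows "X - A \<in> p \<longleftrightarrow> A \<notin> p"
proof -
  have "A \<inter> (X - A) = {}" by blast
  with assms show ?thesis unfolding ultrafilter_on_def by metis
qed

lemma ultrafilter_on_Un_iff:
  assumes p: "ultrafilter_on X p" and AB: "A \<subseteq> X" "B \<subseteq> X"
  shows "A \<union> B \<in> p \<longleftrightarrow> A \<in> p \<or> B \<in> p"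
proof
  assume u: "A \<union> B \<in> p"
  show "A \<in> p \<or> B \<in> p"
  proof (rule ccontr)
    assume "\<not> (A \<in> p \<or> B \<in> p)"
    then have "(X - A) \<inter> (X - B) \<in> p"
      using p AB ultrafilter_on_Diff_iff[OF p] unfolding ultrafilter_on_def by blast
    then have "X - (A \<union> B) \<in> p" by (simp add: Diff_Un)
    with u ultrafilter_on_Diff_iff[OF p, of "A \<union> B"] AB show False by blast
  qed
next
  assume "A \<in> p \<or> B \<in> p"
  with p AB show "A \<union> B \<in> p" unfolding ultrafilter_on_def by (meson Un_least Un_upper1 Un_upper2)
qed

lemma ideal_checkD:
  assumes "p \<in> ideal_check X J"
  shows "ultrafilter_on X p" and "\<And>I. I \<in> J \<Longrightarrow> X - I \<in> p"
  using assms by (auto simp: ideal_check_def beta_remainder_def beta_def)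

section \<open>Translates of sets and of ultrafilters\<close>

lemma translates_eq_UN: "translates \<phi> F A = (\<Union>g\<in>F. \<phi> g ` A)"
  by (auto simp: translates_def)

lemma translates_mono: "A \<subseteq> B \<Longrightarrow> translates \<phi> F A \<subseteq> translates \<phi> F B"
  by (auto simp: translates_def)

lemma translates_Un: "translates \<phi> F (A \<union> B) = translates \<phi> F A \<union> translates \<phi> F B"
  by (auto simp: translates_def)

lemma ultrafilter_on_translates_iff:
  assumes p: "ultrafilter_on X p" and "finite F" and "\<And>g. g \<in> F \<Longrightarrow> \<phi> g ` A \<subseteq> X"
  shows "translates \<phi> F A \<in> p \<longleftrightarrow> (\<exists>g\<in>F. \<phi> g ` A \<in> p)"
  using assms(2,3)
proof (induction F)
  case empty
  then show ?case using p by (simp add: translates_eq_UN ultrafilter_on_def)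
next
  case (insert g F)
  have "translates \<phi> (insert g F) A = \<phi> g ` A \<union> translates \<phi> F A"
    by (auto simp: translates_eq_UN)
  moreover have "translates \<phi> F A \<subseteq> X" using insert.prems by (auto simp: translates_eq_UN)
  ultimately show ?case
    using insert ultrafilter_on_Un_iff[OF p, of "\<phi> g ` A" "translates \<phi> F A"] by simp
qed

lemma translates_in_ideal:
  assumes J: "set_ideal X J" "translation_invariant G \<phi> J"
    and F: "finite F" "F \<subseteq> carrier G" and I: "I \<in> J"
  shows "translates \<phi> F I \<in> J"
  using F
proof (induction F)
  case empty
  have "{} \<in> J" using J(1) I unfolding set_ideal_def by blast
  then show ?case by (simp add: translates_eq_UN)
next
  case (insert g F)
  have "translates \<phi> (insert g F) I = \<phi> g ` I \<union> translates \<phi> F I"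
    by (auto simp: translates_eq_UN)
  with insert J I show ?case unfolding set_ideal_def translation_invariant_def by simp
qed

context group_action
begin

lemma group_G: "group G"
  using group_hom by (rule group_hom.axioms(1))

lemma inv_in_carrier [simp]: "g \<in> carrier G \<Longrightarrow> inv g \<in> carrier G"
  using group_G by (rule group.inv_closed)

lemma image_subset_space:
  assumes "g \<in> carrier G" "A \<subseteq> E"
  shows "\<phi> g ` A \<subseteq> E"
  using assms surj_prop by blast

lemma translates_subset_space: "F \<subseteq> carrier G \<Longrightarrow> A \<subseteq> E \<Longrightarrow> translates \<phi> F A \<subseteq> E"
  unfolding translates_eq_UN by (intro UN_least image_subset_space) auto

lemma mem_image_iff:
  assumes "g \<in> carrier G" "A \<subseteq> E" "x \<in> E"
  shows "x \<in> \<phi> g ` A \<longleftrightarrow> \<phi> (inv g) x \<in> A"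
proof
  assume "x \<in> \<phi> g ` A"
  then obtain a where "a \<in> A" "\<phi> g a = x" by blast
  then show "\<phi> (inv g) x \<in> A" using assms orbit_sym_aux[of g a x] by auto
next
  assume "\<phi> (inv g) x \<in> A"
  moreover have "\<phi> g (\<phi> (inv g) x) = x"
    using orbit_sym_aux[of "inv g" x] assms group.inv_inv[OF group_G] by simp
  ultimately show "x \<in> \<phi> g ` A" by force
qed

lemma image_inv_image:
  assumes "g \<in> carrier G" "A \<subseteq> E"
  shows "\<phi> (inv g) ` \<phi> g ` A = A"
proof -
  have "\<phi> (inv g) (\<phi> g a) = a" if "a \<in> A" for a
    using orbit_sym_aux[OF assms(1)] assms(2) that by blast
  then show ?thesis by (simp add: image_image)
qed

lemma image_image_inv:
  assumes "g \<in> carrier G" "A \<subseteq> E"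
  shows "\<phi> g ` \<phi> (inv g) ` A = A"
  using image_inv_image[OF inv_in_carrier[OF assms(1)] assms(2)]
  by (simp only: group.inv_inv[OF group_G assms(1)])

lemma image_Diff_space:
  assumes "g \<in> carrier G" "A \<subseteq> E"
  shows "\<phi> g ` (E - A) = E - \<phi> g ` A"
  using assms inj_on_image_set_diff[OF inj_prop[OF assms(1)], of E A] surj_prop by simp

lemma translates_one: "A \<subseteq> E \<Longrightarrow> translates \<phi> {\<one>} A = A"
  unfolding translates_eq_UN using id_eq_one[symmetric] by (auto simp: subset_iff)

lemma translates_translates:
  assumes "F \<subseteq> carrier G" "H \<subseteq> carrier G" "A \<subseteq> E"
  shows "translates \<phi> F (translates \<phi> H A) = translates \<phi> (F <#> H) A"
proof -
  have c: "\<phi> (f \<otimes> h) a = \<phi> f (\<phi> h a)" if "f \<in> F" "h \<in> H" "a \<in> A" for f h a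
    using that assms composition_rule by blast
  show ?thesis
  proof (intro equalityI subsetI)
    fix x assume "x \<in> translates \<phi> F (translates \<phi> H A)"
    then obtain f h a where "f \<in> F" "h \<in> H" "a \<in> A" "x = \<phi> (f \<otimes> h) a"
      using c by (auto simp: translates_eq_UN)
    then show "x \<in> translates \<phi> (F <#> H) A"
      unfolding translates_eq_UN set_mult_def by blast
  next
    fix x assume "x \<in> translates \<phi> (F <#> H) A"
    then obtain f h a where "f \<in> F" "h \<in> H" "a \<in> A" "x = \<phi> (f \<otimes> h) a"
      unfolding translates_eq_UN set_mult_def by blast
    then show "x \<in> translates \<phi> F (translates \<phi> H A)"
      using c unfolding translates_eq_UN by auto
  qed
qed

lemma finite_set_mult: "finite F \<Longrightarrow> finite H \<Longrightarrow> finite (F <#> H)"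
  by (simp add: set_mult_def)

lemma set_mult_subset_carrier: "F \<subseteq> carrier G \<Longrightarrow> H \<subseteq> carrier G \<Longrightarrow> F <#> H \<subseteq> carrier G"
  using group_G by (rule group.setmult_subset_G)

lemma mem_translate_uf_iff:
  assumes "p \<subseteq> Pow E" "g \<in> carrier G" "A \<subseteq> E"
  shows "A \<in> translate_uf \<phi> g p \<longleftrightarrow> \<phi> (inv g) ` A \<in> p"
proof
  assume "A \<in> translate_uf \<phi> g p"
  then obtain P where "P \<in> p" "A = \<phi> g ` P" by (auto simp: translate_uf_def)
  then show "\<phi> (inv g) ` A \<in> p" using assms image_inv_image[of g P] by auto
next
  assume "\<phi> (inv g) ` A \<in> p"
  moreover have "A = \<phi> g ` \<phi> (inv g) ` A" using image_image_inv assms by simp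
  ultimately show "A \<in> translate_uf \<phi> g p" unfolding translate_uf_def by blast
qed

lemma companion_empty_iff:
  assumes "p \<subseteq> Pow E" "A \<subseteq> E"
  shows "companion G \<phi> p A = {} \<longleftrightarrow> (\<forall>g\<in>carrier G. \<phi> g ` A \<notin> p)"
proof -
  have "companion G \<phi> p A = {} \<longleftrightarrow> (\<forall>g\<in>carrier G. \<phi> (inv g) ` A \<notin> p)"
    using mem_translate_uf_iff[OF assms(1) _ assms(2)] by (auto simp: companion_def)
  also have "\<dots> \<longleftrightarrow> (\<forall>g\<in>carrier G. \<phi> g ` A \<notin> p)"
    by (metis group.inv_inv[OF group_G] inv_in_carrier)
  finally show ?thesis .
qed

text \<open>
  Membership of \<open>A\<close> in \<open>gp\<close> depends only on the ultrafilter \<open>gp\<close>, so \<open>\<triangle>\<^sub>p(A) = Gp\<close> says that every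
  \<open>gp\<close> contains \<open>A\<close>, that is, that no \<open>gp\<close> contains \<open>X - A\<close>.
\<close>

lemma companion_eq_orbit_iff:
  assumes p: "ultrafilter_on E p" and A: "A \<subseteq> E"
  shows "companion G \<phi> p A = uf_orbit G \<phi> p \<longleftrightarrow> companion G \<phi> p (E - A) = {}"
proof -
  have pE: "p \<subseteq> Pow E" using p by (simp add: ultrafilter_on_def)
  have *: "E - A \<in> translate_uf \<phi> g p \<longleftrightarrow> A \<notin> translate_uf \<phi> g p" if g: "g \<in> carrier G" for g
    using g A pE ultrafilter_on_Diff_iff[OF p, of "\<phi> (inv g) ` A"]
    by (simp add: mem_translate_uf_iff image_Diff_space image_subset_space)
  have "companion G \<phi> p A = uf_orbit G \<phi> p \<longleftrightarrow> (\<forall>g\<in>carrier G. A \<in> translate_uf \<phi> g p)"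
    unfolding companion_def uf_orbit_def by blast
  also have "\<dots> \<longleftrightarrow> companion G \<phi> p (E - A) = {}"
    using * by (auto simp: companion_def)
  finally show ?thesis .
qed

section \<open>Large, thick and small sets\<close>

lemma large_setI:
  assumes J: "set_ideal E J" and F: "finite F" "F \<subseteq> carrier G" and A: "A \<subseteq> E"
    and I: "I \<in> J" and cover: "E \<subseteq> translates \<phi> F A \<union> I"
  shows "large_set G E \<phi> J A"
proof -
  have "I \<subseteq> E" using J I unfolding set_ideal_def by blast
  then have "E = translates \<phi> F A \<union> I" using cover translates_subset_space[OF F(2) A] by blast
  with F I show ?thesis unfolding large_set_def by blast
qed

text \<open>
  The complement of \<open>Int\<^sub>F(A)\<close> is \<open>(X - A) \<union> F\<^sup>-\<^sup>1(X - A)\<close>, so a finite \<open>F\<close> refutes the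
  thickness of \<open>A\<close> exactly when the translates of \<open>X - A\<close> by \<open>F\<^sup>-\<^sup>1 \<union> {\<one>}\<close> cover \<open>X\<close> modulo \<open>J\<close>.
\<close>

lemma thick_set_iff:
  assumes J: "set_ideal E J" and A: "A \<subseteq> E"
  shows "thick_set G \<phi> J A \<longleftrightarrow> \<not> large_set G E \<phi> J (E - A)"
proof
  assume t: "thick_set G \<phi> J A"
  show "\<not> large_set G E \<phi> J (E - A)"
  proof
    assume "large_set G E \<phi> J (E - A)"
    then obtain F I where F: "finite F" "F \<subseteq> carrier G" and I: "I \<in> J"
      and cov: "E = translates \<phi> F (E - A) \<union> I" unfolding large_set_def by blast
    let ?F = "(\<lambda>g. inv g) ` F"
    have "Int_translates \<phi> ?F A \<subseteq> I"
    proof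
      fix x assume "x \<in> Int_translates \<phi> ?F A"
      then have xA: "x \<in> A" and *: "\<And>g. g \<in> F \<Longrightarrow> \<phi> (inv g) x \<in> A"
        by (auto simp: Int_translates_def translates_eq_UN)
      have "x \<notin> \<phi> g ` (E - A)" if "g \<in> F" for g
        using mem_image_iff[of g "E - A" x] *[OF that] that F xA A by blast
      with xA A cov show "x \<in> I" by (auto simp: translates_eq_UN)
    qed
    then have "Int_translates \<phi> ?F A \<in> J" using J I unfolding set_ideal_def by blast
    with t F show False unfolding thick_set_def by (metis finite_imageI image_subsetI inv_in_carrier subsetD)
  qed
next
  assume nl: "\<not> large_set G E \<phi> J (E - A)"
  show "thick_set G \<phi> J A"
    unfolding thick_set_def
  proof (intro allI impI notI)
    fix F assume F: "finite F \<and> F \<subseteq> carrier G" and I: "Int_translates \<phi> F A \<in> J"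
    let ?F = "insert \<one> ((\<lambda>g. inv g) ` F)"
    have one: "\<one> \<in> carrier G" using group_G group.is_monoid monoid.one_closed by blast
    have FG: "finite ?F" "?F \<subseteq> carrier G" using F one by auto
    have "E \<subseteq> translates \<phi> ?F (E - A) \<union> Int_translates \<phi> F A"
    proof
      fix x assume x: "x \<in> E"
      show "x \<in> translates \<phi> ?F (E - A) \<union> Int_translates \<phi> F A"
      proof (cases "x \<in> A")
        case False
        with x have "x \<in> translates \<phi> {\<one>} (E - A)" by (simp add: translates_one)
        then show ?thesis by (auto simp: translates_eq_UN)
      next
        case True
        show ?thesis
        proof (cases "\<forall>g\<in>F. \<phi> g x \<in> A")
          case True
          with \<open>x \<in> A\<close> show ?thesis by (auto simp: Int_translates_def translates_eq_UN)
        next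
          case False
          then obtain g where g: "g \<in> F" "\<phi> g x \<notin> A" by blast
          then have gG: "g \<in> carrier G" using F by blast
          have "\<phi> g x \<in> E" using element_image[OF gG x] by simp
          then have "x \<in> \<phi> (inv g) ` (E - A)"
            using mem_image_iff[of "inv g" "E - A" x] gG g x group.inv_inv[OF group_G] by simp
          with g show ?thesis by (auto simp: translates_eq_UN)
        qed
      qed
    qed
    then have "large_set G E \<phi> J (E - A)" using large_setI[OF J FG _ I, of "E - A"] by blast
    with nl show False ..
  qed
qed

lemma large_set_translate:
  assumes g: "g \<in> carrier G" and A: "A \<subseteq> E"
    and large: "large_set G E \<phi> J (\<phi> g ` A)" and J: "set_ideal E J"
  shows "large_set G E \<phi> J A"
proof -
  from large obtain F I where F: "finite F" "F \<subseteq> carrier G" and I: "I \<in> J"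
    and cov: "E = translates \<phi> F (\<phi> g ` A) \<union> I" unfolding large_set_def by blast
  have "\<phi> g ` A = translates \<phi> {g} A" by (simp add: translates_eq_UN)
  then have "E \<subseteq> translates \<phi> (F <#> {g}) A \<union> I"
    using cov translates_translates[of F "{g}" A] F g A by auto
  then show ?thesis
    using large_setI[OF J finite_set_mult[OF F(1)] set_mult_subset_carrier[OF F(2)] A I, of "{g}"] g by blast
qed

lemma large_set_translate_iff:
  assumes "g \<in> carrier G" "A \<subseteq> E" "set_ideal E J"
  shows "large_set G E \<phi> J (\<phi> g ` A) \<longleftrightarrow> large_set G E \<phi> J A"
  using large_set_translate[of g A J] large_set_translate[of "inv g" "\<phi> g ` A" J]
    assms image_inv_image image_subset_space by auto

text \<open>A translate \<open>gA\<close> of a small set is small because \<open>L - gA = g(g\<^sup>-\<^sup>1L - A)\<close>.\<close>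

lemma small_set_image:
  assumes g: "g \<in> carrier G" and A: "A \<subseteq> E" and J: "set_ideal E J"
    and small: "small_set G E \<phi> J A"
  shows "small_set G E \<phi> J (\<phi> g ` A)"
  unfolding small_set_def
proof (intro allI impI)
  fix L assume L: "L \<subseteq> E \<and> large_set G E \<phi> J L"
  let ?L = "\<phi> (inv g) ` L"
  have LE: "?L \<subseteq> E" using L g image_subset_space[of "inv g" L] by simp
  have "large_set G E \<phi> J ?L" using large_set_translate_iff[of "inv g" L J] g L J by simp
  with LE small have "large_set G E \<phi> J (?L - A)" unfolding small_set_def by blast
  then have "large_set G E \<phi> J (\<phi> g ` (?L - A))"
    using large_set_translate_iff[of g "?L - A" J] g J LE by blast
  moreover have "\<phi> g ` ?L = L" using image_image_inv g L by simp
  ultimately show "large_set G E \<phi> J (L - \<phi> g ` A)"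
    using inj_on_image_set_diff[OF inj_prop[OF g], of ?L A] LE A by fastforce
qed

text \<open>
  Removing \<open>FA\<close> from a large set means removing the small sets \<open>gA\<close>, \<open>g \<in> F\<close>, one after another,
  and each removal keeps the set large.
\<close>

lemma small_set_translates:
  assumes F: "finite F" "F \<subseteq> carrier G" and A: "A \<subseteq> E" and J: "set_ideal E J"
    and small: "small_set G E \<phi> J A"
  shows "small_set G E \<phi> J (translates \<phi> F A)"
  using F
proof (induction F)
  case empty
  then show ?case by (simp add: translates_eq_UN small_set_def)
next
  case (insert g F)
  have "small_set G E \<phi> J (\<phi> g ` A)" using small_set_image insert.prems A J small by simp
  moreover have "L - translates \<phi> (insert g F) A = (L - \<phi> g ` A) - translates \<phi> F A" for L
    by (auto simp: translates_eq_UN)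
  ultimately show ?case
    using insert unfolding small_set_def by (simp add: subset_iff)
qed

text \<open>
  If \<open>A\<close> is small, then so is every \<open>FA\<close>, and taking \<open>X\<close> itself as the large set shows that \<open>X - FA\<close>
  is large.  Conversely, suppose all these complements are large and \<open>X = FL \<union> I\<close>.  A point
  of \<open>X - FA\<close> outside \<open>I\<close> has the form \<open>fl\<close> with \<open>l \<in> L\<close>, and \<open>l \<notin> A\<close>; so \<open>X - FA \<subseteq> F(L - A) \<union> I\<close>,
  and \<open>L - A\<close> inherits largeness from \<open>X - FA\<close>.
\<close>

lemma small_set_iff:
  assumes J: "set_ideal E J" and inv: "translation_invariant G \<phi> J" and A: "A \<subseteq> E"
  shows "small_set G E \<phi> J A \<longleftrightarrow> \<not> prethick_set G \<phi> J A"
proof -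
  have prethick: "\<not> prethick_set G \<phi> J A \<longleftrightarrow>
      (\<forall>F. finite F \<and> F \<subseteq> carrier G \<longrightarrow> large_set G E \<phi> J (E - translates \<phi> F A))"
    using thick_set_iff[OF J translates_subset_space[OF _ A]] unfolding prethick_set_def by blast
  show ?thesis
    unfolding prethick
  proof (intro iffI allI impI)
    fix F assume s: "small_set G E \<phi> J A" and F: "finite F \<and> F \<subseteq> carrier G"
    have "{} \<in> J" using J unfolding set_ideal_def by blast
    moreover have "E \<subseteq> translates \<phi> {\<one>} E \<union> {}" by (simp add: translates_one)
    ultimately have "large_set G E \<phi> J E"
      using large_setI[OF J, of "{\<one>}" E "{}"] group.is_monoid[OF group_G] monoid.one_closed by blast
    then show "large_set G E \<phi> J (E - translates \<phi> F A)"
      using small_set_translates[OF _ _ A J s] F unfolding small_set_def by blast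
  next
    assume *: "\<forall>F. finite F \<and> F \<subseteq> carrier G \<longrightarrow> large_set G E \<phi> J (E - translates \<phi> F A)"
    show "small_set G E \<phi> J A"
      unfolding small_set_def
    proof (intro allI impI)
      fix L assume "L \<subseteq> E \<and> large_set G E \<phi> J L"
      then obtain F I where L: "L \<subseteq> E" and F: "finite F" "F \<subseteq> carrier G" and I: "I \<in> J"
        and cov: "E = translates \<phi> F L \<union> I" unfolding large_set_def by blast
      from * F have "large_set G E \<phi> J (E - translates \<phi> F A)" by blast
      then obtain H I' where H: "finite H" "H \<subseteq> carrier G" and I': "I' \<in> J"
        and cov': "E = translates \<phi> H (E - translates \<phi> F A) \<union> I'"
        unfolding large_set_def by blast
      have cov_E: "E \<subseteq> translates \<phi> F L \<union> I"
        using cov by (rule equalityD1)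
      have "translates \<phi> F L \<subseteq> translates \<phi> F (L - A) \<union> translates \<phi> F A"
        unfolding translates_eq_UN by blast
      then have "E - translates \<phi> F A \<subseteq> translates \<phi> F (L - A) \<union> I"
        using cov_E by blast
      then have "translates \<phi> H (E - translates \<phi> F A)
          \<subseteq> translates \<phi> H (translates \<phi> F (L - A)) \<union> translates \<phi> H I"
        unfolding translates_Un[symmetric] by (rule translates_mono)
      moreover have "translates \<phi> H (translates \<phi> F (L - A)) = translates \<phi> (H <#> F) (L - A)"
        using translates_translates[OF H(2) F(2)] L by blast
      ultimately have "E \<subseteq> translates \<phi> (H <#> F) (L - A) \<union> (translates \<phi> H I \<union> I')"
        using equalityD1[OF cov'] by blast
      moreover have "translates \<phi> H I \<union> I' \<in> J"
        using translates_in_ideal[OF J inv H I] I' J by (simp add: set_ideal_def)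
      ultimately show "large_set G E \<phi> J (L - A)"
        using large_setI[OF J finite_set_mult[OF H(1) F(1)] set_mult_subset_carrier[OF H(2) F(2)],
            of "L - A"] L
        by blast
    qed
  qed
qed

end

section \<open>Companions detect largeness\<close>

context transitive_action
begin

lemma finite_subset_translates:
  assumes D: "finite D" "D \<subseteq> E" and b: "b \<in> E"
  obtains F where "finite F" "F \<subseteq> carrier G" "D \<subseteq> translates \<phi> F {b}"
proof -
  have "\<forall>d\<in>D. \<exists>g. g \<in> carrier G \<and> \<phi> g b = d" using D(2) b unique_orbit by blast
  then obtain f where f: "\<And>d. d \<in> D \<Longrightarrow> f d \<in> carrier G \<and> \<phi> (f d) b = d" by metis
  show thesis
  proof
    show "finite (f ` D)" using D(1) by simp
    show "f ` D \<subseteq> carrier G" using f by blast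
    show "D \<subseteq> translates \<phi> (f ` D) {b}" using f by (auto simp: translates_eq_UN)
  qed
qed

text \<open>
  Since \<open>X\<close> is infinite, \<open>A\<close> or \<open>I\<close> has a point \<open>b\<close>, and transitivity covers the finite set \<open>D\<close> by
  finitely many translates of \<open>b\<close>.  If \<open>b \<in> A\<close>, these are absorbed by enlarging \<open>F\<close>; if \<open>b \<in> I\<close>, by
  replacing \<open>I\<close> with a union of translates of \<open>I\<close>, which is in \<open>J\<close> by invariance.  This is what makes it possible to choose
  nonprincipal ultrafilters even when \<open>J\<close> does not contain the finite sets.
\<close>

lemma large_set_if_finite_remainder:
  assumes J: "set_ideal E J" and inv: "translation_invariant G \<phi> J" and inf: "infinite E"
    and A: "A \<subseteq> E" and F: "finite F" "F \<subseteq> carrier G" and I: "I \<in> J" and D: "finite D"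
    and cov: "E \<subseteq> translates \<phi> F A \<union> I \<union> D"
  shows "large_set G E \<phi> J A"
proof -
  have IE: "I \<subseteq> E" using J I unfolding set_ideal_def by blast
  have "A \<noteq> {} \<or> I \<noteq> {}"
  proof (rule ccontr)
    assume "\<not> (A \<noteq> {} \<or> I \<noteq> {})"
    then have "E \<subseteq> D" using cov by (auto simp: translates_eq_UN)
    with inf D show False using finite_subset by blast
  qed
  then obtain b where b: "b \<in> A \<or> b \<in> I" by blast
  then have "b \<in> E" using A IE by blast
  then obtain H where H: "finite H" "H \<subseteq> carrier G" "D \<inter> E \<subseteq> translates \<phi> H {b}"
    using finite_subset_translates[of "D \<inter> E" b] D by blast
  from b show ?thesis
  proof
    assume "b \<in> A"
    with H(3) have "D \<inter> E \<subseteq> translates \<phi> H A" unfolding translates_eq_UN by blast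
    then have "E \<subseteq> translates \<phi> (F \<union> H) A \<union> I" using cov by (auto simp: translates_eq_UN)
    then show ?thesis using large_setI[OF J _ _ A I, of "F \<union> H"] F H by blast
  next
    assume "b \<in> I"
    with H(3) have "D \<inter> E \<subseteq> translates \<phi> H I" unfolding translates_eq_UN by blast
    then have "E \<subseteq> translates \<phi> F A \<union> (translates \<phi> H I \<union> I)" using cov by blast
    moreover have "translates \<phi> H I \<union> I \<in> J"
      using translates_in_ideal[OF J inv H(1,2) I] I J by (simp add: set_ideal_def)
    ultimately show ?thesis using large_setI[OF J F A] by blast
  qed
qed

text \<open>
  For a set \<open>A\<close> that is not large, the sets covered by some \<open>FA \<union> I \<union> D\<close> form an ideal.  It contains
  \<open>J\<close> and the finite sets, so a dual ultrafilter belongs to \<open>\<check>J\<close>, and it contains the translates of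
  \<open>A\<close>, so the companion is empty.
\<close>

lemma companion_empty_exists:
  assumes J: "set_ideal E J" and inv: "translation_invariant G \<phi> J" and inf: "infinite E"
    and A: "A \<subseteq> E" and nl: "\<not> large_set G E \<phi> J A"
  obtains p where "p \<in> ideal_check E J" "companion G \<phi> p A = {}"
proof -
  let ?P = "\<lambda>B F I D. finite F \<and> F \<subseteq> carrier G \<and> I \<in> J \<and> finite D \<and>
    B \<subseteq> translates \<phi> F A \<union> I \<union> D"
  define K where "K = {B. B \<subseteq> E \<and> (\<exists>F I D. ?P B F I D)}"
  have emp: "{} \<in> J" using J unfolding set_ideal_def by blast
  have KI: "B \<in> K" if "B \<subseteq> E" "?P B F I D" for B F I D
    using that unfolding K_def by blast
  have KE: "\<And>B. B \<in> K \<Longrightarrow> B \<subseteq> E"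
    and KD: "\<And>B. B \<in> K \<Longrightarrow> \<exists>F I D. ?P B F I D"
    unfolding K_def by blast+
  have "set_ideal E K"
  proof (rule set_idealI)
    show "K \<subseteq> Pow E" using KE by blast
    have "{} \<in> K" using emp by (intro KI[of _ "{}" "{}" "{}"]) auto
    then show "K \<noteq> {}" by blast
    show "E \<notin> K"
    proof
      assume "E \<in> K"
      from KD[OF this] obtain F I D where "?P E F I D" by auto
      then have "large_set G E \<phi> J A"
        by (intro large_set_if_finite_remainder[OF J inv inf A, of F I D]) auto
      with nl show False ..
    qed
  next
    fix B B' assume BB: "B \<in> K" "B' \<in> K"
    from KD[OF BB(1)] obtain F I D where P: "?P B F I D" by auto
    from KD[OF BB(2)] obtain F' I' D' where P': "?P B' F' I' D'" by auto
    have "translates \<phi> (F \<union> F') A = translates \<phi> F A \<union> translates \<phi> F' A"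
      by (auto simp: translates_eq_UN)
    then have "B \<union> B' \<subseteq> translates \<phi> (F \<union> F') A \<union> (I \<union> I') \<union> (D \<union> D')" using P P' by blast
    moreover have "I \<union> I' \<in> J" using J P P' by (simp add: set_ideal_def)
    ultimately show "B \<union> B' \<in> K"
      using KE[OF BB(1)] KE[OF BB(2)] P P' by (intro KI[of _ "F \<union> F'" "I \<union> I'" "D \<union> D'"]) auto
  next
    fix B B' assume B: "B \<in> K" "B' \<subseteq> B"
    from KD[OF B(1)] obtain F I D where "?P B F I D" by auto
    then show "B' \<in> K" using KE[OF B(1)] B(2) by (intro KI[of _ F I D]) auto
  qed
  then obtain p where p: "ultrafilter_on E p" and pK: "\<And>B. B \<in> K \<Longrightarrow> E - B \<in> p"
    by (rule ideal_dual_ultrafilter_exists) blast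
  have "p \<noteq> principal_ultrafilter E x" if x: "x \<in> E" for x
  proof
    assume eq: "p = principal_ultrafilter E x"
    have "{x} \<in> K" using x emp by (intro KI[of _ "{}" "{}" "{x}"]) auto
    from pK[OF this] eq show False by (simp add: principal_ultrafilter_def)
  qed
  moreover have "E - I \<in> p" if I: "I \<in> J" for I
    using I J by (intro pK KI[of _ "{}" I "{}"]) (auto simp: set_ideal_def)
  ultimately have "p \<in> ideal_check E J"
    using p by (auto simp: ideal_check_def beta_remainder_def beta_def)
  moreover have "companion G \<phi> p A = {}"
  proof -
    have "\<phi> g ` A \<notin> p" if g: "g \<in> carrier G" for g
    proof -
      have gA: "\<phi> g ` A \<subseteq> E" using image_subset_space[OF g A] .
      then have "\<phi> g ` A \<in> K"
        using g emp by (intro KI[of _ "{g}" "{}" "{}"]) (auto simp: translates_eq_UN)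
      then show ?thesis using pK ultrafilter_on_Diff_iff[OF p gA] by blast
    qed
    then show ?thesis using companion_empty_iff[of p A] p A by (simp add: ultrafilter_on_def)
  qed
  ultimately show thesis by (rule that)
qed

lemma large_set_iff_companion:
  assumes J: "set_ideal E J" and inv: "translation_invariant G \<phi> J" and inf: "infinite E"
    and A: "A \<subseteq> E"
  shows "large_set G E \<phi> J A \<longleftrightarrow> (\<forall>p\<in>ideal_check E J. companion G \<phi> p A \<noteq> {})"
proof
  assume "large_set G E \<phi> J A"
  then obtain F I where F: "finite F" "F \<subseteq> carrier G" and I: "I \<in> J"
    and cov: "E = translates \<phi> F A \<union> I" unfolding large_set_def by blast
  have IE: "I \<subseteq> E" using J I unfolding set_ideal_def by blast
  show "\<forall>p\<in>ideal_check E J. companion G \<phi> p A \<noteq> {}"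
  proof
    fix p assume "p \<in> ideal_check E J"
    note p = ideal_checkD[OF this]
    have "I \<notin> p" using p(2)[OF I] ultrafilter_on_Diff_iff[OF p(1) IE] by blast
    moreover have "translates \<phi> F A \<union> I \<in> p"
      using p(1) cov by (simp add: ultrafilter_on_def)
    ultimately have "translates \<phi> F A \<in> p"
      using ultrafilter_on_Un_iff[OF p(1) translates_subset_space[OF F(2) A] IE] by blast
    moreover have "\<And>g. g \<in> F \<Longrightarrow> \<phi> g ` A \<subseteq> E" using image_subset_space F(2) A by blast
    ultimately obtain g where "g \<in> F" "\<phi> g ` A \<in> p"
      using ultrafilter_on_translates_iff[OF p(1) F(1)] by blast
    then show "companion G \<phi> p A \<noteq> {}"
      using companion_empty_iff[of p A] p(1) F(2) A by (auto simp: ultrafilter_on_def)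
  qed
next
  assume "\<forall>p\<in>ideal_check E J. companion G \<phi> p A \<noteq> {}"
  then show "large_set G E \<phi> J A"
    using companion_empty_exists[OF J inv inf A] by blast
qed

lemma thick_set_iff_companion:
  assumes J: "set_ideal E J" and inv: "translation_invariant G \<phi> J" and inf: "infinite E"
    and A: "A \<subseteq> E"
  shows "thick_set G \<phi> J A \<longleftrightarrow> (\<exists>p\<in>ideal_check E J. companion G \<phi> p A = uf_orbit G \<phi> p)"
proof -
  have "thick_set G \<phi> J A \<longleftrightarrow> (\<exists>p\<in>ideal_check E J. companion G \<phi> p (E - A) = {})"
    using thick_set_iff[OF J A] large_set_iff_companion[OF J inv inf, of "E - A"] by blast
  also have "\<dots> \<longleftrightarrow> (\<exists>p\<in>ideal_check E J. companion G \<phi> p A = uf_orbit G \<phi> p)"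
    using companion_eq_orbit_iff[OF ideal_checkD(1) A] by blast
  finally show ?thesis .
qed

lemma prethick_set_iff_companion:
  assumes J: "set_ideal E J" and inv: "translation_invariant G \<phi> J" and inf: "infinite E"
    and A: "A \<subseteq> E"
  shows "prethick_set G \<phi> J A \<longleftrightarrow> (\<exists>p\<in>ideal_check E J. \<exists>F. finite F \<and> F \<subseteq> carrier G \<and>
    companion G \<phi> p (translates \<phi> F A) = uf_orbit G \<phi> p)"
proof -
  have "prethick_set G \<phi> J A \<longleftrightarrow> (\<exists>F. finite F \<and> F \<subseteq> carrier G \<and>
      (\<exists>p\<in>ideal_check E J. companion G \<phi> p (translates \<phi> F A) = uf_orbit G \<phi> p))"
    unfolding prethick_set_def
    by (simp add: thick_set_iff_companion[OF J inv inf translates_subset_space[OF _ A]]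
        cong: conj_cong)
  then show ?thesis by blast
qed

end

theorem theorem3p1:
  fixes G :: "('g, 'm) monoid_scheme"
    and X :: "'x set"
    and \<phi> :: "'g \<Rightarrow> 'x \<Rightarrow> 'x"
    and J :: "'x set set"
    and A :: "'x set"
  assumes "transitive_action G X \<phi>"
    and "infinite X"
    and "set_ideal X J"
    and "translation_invariant G \<phi> J"
    and "A \<subseteq> X"
  shows "(large_set G X \<phi> J A \<longleftrightarrow> (\<forall>p\<in>ideal_check X J. companion G \<phi> p A \<noteq> {})) \<and>
    (thick_set G \<phi> J A \<longleftrightarrow> (\<exists>p\<in>ideal_check X J. companion G \<phi> p A = uf_orbit G \<phi> p)) \<and>
    (prethick_set G \<phi> J A \<longleftrightarrow>
      (\<exists>p\<in>ideal_check X J. \<exists>F. finite F \<and> F \<subseteq> carrier G \<and>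
         companion G \<phi> p (translates \<phi> F A) = uf_orbit G \<phi> p)) \<and>
    (small_set G X \<phi> J A \<longleftrightarrow>
      (\<forall>p\<in>ideal_check X J. \<forall>F. finite F \<and> F \<subseteq> carrier G \<longrightarrow>
         companion G \<phi> p (translates \<phi> F A) \<noteq> uf_orbit G \<phi> p))"
proof -
  interpret transitive_action G X \<phi> by fact
  note hyps = assms(3,4,2,5)
  have "small_set G X \<phi> J A \<longleftrightarrow>
      (\<forall>p\<in>ideal_check X J. \<forall>F. finite F \<and> F \<subseteq> carrier G \<longrightarrow>
         companion G \<phi> p (translates \<phi> F A) \<noteq> uf_orbit G \<phi> p)"
    unfolding small_set_iff[OF assms(3-5)] prethick_set_iff_companion[OF hyps] by blast
  with large_set_iff_companion[OF hyps] thick_set_iff_companion[OF hyps]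
    prethick_set_iff_companion[OF hyps]
  show ?thesis by (intro conjI)
qed

end
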